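(* Let $N$ be a (not necessarily abelian) group, let $\varphi:\mathbb{Z}_2\to\mathrm{Aut}(N)$ be a group homomorphism, and let $G=N\rtimes_\varphi\mathbb{Z}_2$ be a group of (finite) size $n$. Then, for any even $k\ge 4$, every subset of type $(k/2,k/2)$ of $G\setminus\{(0,0)\}$ admits an alternating parity $3$-weak sequencing.
   Context: Groups are written additively, even when non-abelian. The group $N\rtimes_\varphi\mathbb{Z}_2$ has elements $(x,a)$ with $x\in N$, $a\in\mathbb{Z}_2$, and operation $(x_1,a_1)+(x_2,a_2)=(x_1+\varphi(a_1)(x_2),\,a_1+a_2)$; its identity is $(0,0)$. Elements $(x,0)$ are called even and elements $(x,1)$ odd. A finite subset $S$ has type $(\lambda_0,\lambda_1)$ if it contains exactly $\lambda_0$ even elements and $\lambda_1$ odd elements. A $t$-weak sequencing of a set $S$ of size $k$ is an ordering $(y_1,\ldots,y_k)$ of its elements such that the partial sums $s_0=0$ and $s_i=y_1+y_2+\cdots+y_i$ ($1\le i\le k$, sums taken in this order) satisfy $s_i\neq s_j$ for all $0\le i,j\le k$ with $1\le |i-j|\le t$. It is alternating parity if even and odd elements alternate in the ordering, i.e. any two consecutive elements have different parity. *)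

theory Defs
  imports "HOL-Algebra.Algebra"
begin

text \<open>
  HOL-Algebra writes groups multiplicatively: sums are rendered by \<open>\<otimes>\<close> and the identity by
  \<open>\<one>\<close>; no commutativity is assumed anywhere.  The cyclic group of order two is
  \<^term>\<open>integer_mod_group 2\<close>, with carrier \<open>{0, 1}\<close> and addition modulo 2.
\<close>

definition semidirect_product ::
  "('a, 'm) monoid_scheme \<Rightarrow> ('c, 'n) monoid_scheme \<Rightarrow> ('c \<Rightarrow> 'a \<Rightarrow> 'a) \<Rightarrow> ('a \<times> 'c) monoid"
  where "semidirect_product N H \<phi> =
    \<lparr>carrier = carrier N \<times> carrier H,
     monoid.mult = (\<lambda>(x1, a1) (x2, a2). (x1 \<otimes>\<^bsub>N\<^esub> \<phi> a1 x2, a1 \<otimes>\<^bsub>H\<^esub> a2)),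
     one = (\<one>\<^bsub>N\<^esub>, \<one>\<^bsub>H\<^esub>)\<rparr>"

lemma semidirect_product_simps [simp]:
  "carrier (semidirect_product N H \<phi>) = carrier N \<times> carrier H"
  "(x1, a1) \<otimes>\<^bsub>semidirect_product N H \<phi>\<^esub> (x2, a2) = (x1 \<otimes>\<^bsub>N\<^esub> \<phi> a1 x2, a1 \<otimes>\<^bsub>H\<^esub> a2)"
  "\<one>\<^bsub>semidirect_product N H \<phi>\<^esub> = (\<one>\<^bsub>N\<^esub>, \<one>\<^bsub>H\<^esub>)"
  by (simp_all add: semidirect_product_def)

lemma group_semidirect_product:
  assumes "group N" "group H" and \<phi>: "\<phi> \<in> hom H (AutoGroup N)"
  shows "group (semidirect_product N H \<phi>)"
proof -
  interpret N: group N by fact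
  interpret H: group H by fact
  have aut: "\<phi> a \<in> auto N" if "a \<in> carrier H" for a
    using \<phi> that by (auto simp: hom_def AutoGroup_def)
  have hom: "\<phi> a \<in> hom N N" if "a \<in> carrier H" for a
    using aut[OF that] by (simp add: auto_def)
  have closed: "\<phi> a x \<in> carrier N" if "a \<in> carrier H" "x \<in> carrier N" for a x
    using hom_in_carrier[OF hom] that by blast
  have dist: "\<phi> a (x \<otimes>\<^bsub>N\<^esub> y) = \<phi> a x \<otimes>\<^bsub>N\<^esub> \<phi> a y"
    if "a \<in> carrier H" "x \<in> carrier N" "y \<in> carrier N" for a x y
    using hom_mult[OF hom] that by blast
  have act: "\<phi> (a \<otimes>\<^bsub>H\<^esub> b) x = \<phi> a (\<phi> b x)"
    if "a \<in> carrier H" "b \<in> carrier H" "x \<in> carrier N" for a b x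
  proof -
    have "\<phi> (a \<otimes>\<^bsub>H\<^esub> b) = \<phi> a \<otimes>\<^bsub>AutoGroup N\<^esub> \<phi> b"
      using hom_mult[OF \<phi>] that by blast
    also have "\<dots> = compose (carrier N) (\<phi> a) (\<phi> b)"
      using aut that by (simp add: AutoGroup_def BijGroup_def auto_def)
    finally show ?thesis
      using that by (simp add: compose_def)
  qed
  have "group (AutoGroup N)"
    using N.AutoGroup .
  then have "\<phi> \<one>\<^bsub>H\<^esub> = \<one>\<^bsub>AutoGroup N\<^esub>"
    using hom_one[OF \<phi> \<open>group H\<close>] by blast
  then have one: "\<phi> \<one>\<^bsub>H\<^esub> x = x" if "x \<in> carrier N" for x
    using that by (simp add: AutoGroup_def BijGroup_def)
  show ?thesis
  proof (rule groupI, goal_cases)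
    case (5 p)
    then obtain x a where p: "p = (x, a)" and xa: "x \<in> carrier N" "a \<in> carrier H"
      by auto
    let ?b = "inv\<^bsub>H\<^esub> a"
    have b: "?b \<in> carrier H"
      using xa by simp
    have "inv\<^bsub>N\<^esub> \<phi> ?b x \<otimes>\<^bsub>N\<^esub> \<phi> ?b x = \<one>\<^bsub>N\<^esub>"
      using closed[OF b xa(1)] by simp
    then show ?case
      using p xa closed[OF b xa(1)]
      by (intro bexI[of _ "(inv\<^bsub>N\<^esub> \<phi> ?b x, ?b)"]) auto
  qed (auto simp: closed dist act one N.m_assoc H.m_assoc)
qed

definition even_element :: "'a \<times> int \<Rightarrow> bool"
  where "even_element g \<longleftrightarrow> snd g = 0"

definition odd_element :: "'a \<times> int \<Rightarrow> bool"
  where "odd_element g \<longleftrightarrow> snd g = 1"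

definition has_type :: "('a \<times> int) set \<Rightarrow> nat \<Rightarrow> nat \<Rightarrow> bool"
  where "has_type S l0 l1 \<longleftrightarrow>
    finite S \<and> card {g \<in> S. even_element g} = l0 \<and> card {g \<in> S. odd_element g} = l1"

definition partial_sum :: "('g, 'm) monoid_scheme \<Rightarrow> 'g list \<Rightarrow> nat \<Rightarrow> 'g"
  where "partial_sum G ys i = foldl (\<lambda>x y. x \<otimes>\<^bsub>G\<^esub> y) \<one>\<^bsub>G\<^esub> (take i ys)"

definition weak_sequencing :: "('g, 'm) monoid_scheme \<Rightarrow> nat \<Rightarrow> 'g set \<Rightarrow> 'g list \<Rightarrow> bool"
  where "weak_sequencing G t S ys \<longleftrightarrow>
    distinct ys \<and> set ys = S \<and>
    (\<forall>i j. i \<le> length ys \<and> j \<le> length ys \<and>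
       1 \<le> \<bar>int i - int j\<bar> \<and> \<bar>int i - int j\<bar> \<le> int t \<longrightarrow>
       partial_sum G ys i \<noteq> partial_sum G ys j)"

definition alternating_parity :: "('a \<times> int) list \<Rightarrow> bool"
  where "alternating_parity ys \<longleftrightarrow>
    successively (\<lambda>g h. even_element g \<and> odd_element h \<or> odd_element g \<and> even_element h) ys"

end

theory Submission
  imports Defs
begin

text \<open>
  In an alternating ordering, every window of two elements and every window even-odd-even has odd
  sum, so the only windows of length at most 3 whose sum could vanish are those of the form
  odd-even-odd.  Hence the odd elements may be listed in any order, and the even ones inserted
  greedily: each gap between two consecutive odd elements forbids at most one even element, while at
  least two are still unused, since the last one is only placed after the last odd element.
\<close>

lemma partial_sum_Suc:
  assumes "i < length ys"
  shows "partial_sum G ys (Suc i) = partial_sum G ys i \<otimes>\<^bsub>G\<^esub> ys ! i"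
  using assms by (simp add: partial_sum_def take_Suc_conv_app_nth)

lemma (in group) partial_sum_closed:
  assumes "set ys \<subseteq> carrier G" "i \<le> length ys"
  shows "partial_sum G ys i \<in> carrier G"
  using assms(2)
proof (induction i)
  case 0
  then show ?case by (simp add: partial_sum_def)
next
  case (Suc i)
  then show ?case
    using assms(1) by (auto simp: partial_sum_Suc subset_iff)
qed

text \<open>Two partial sums differ by right multiplication with the product of the window between
  them, so by left cancellation they agree only if that product is \<open>\<one>\<close>. For t = 3
  the windows have length one, two or three, one hypothesis for each.\<close>

lemma (in group) weak_sequencing_3I:
  assumes "distinct ys" and S: "set ys = S" "S \<subseteq> carrier G"
    and one: "\<And>i. i < length ys \<Longrightarrow> ys ! i \<noteq> \<one>"
    and two: "\<And>i. Suc i < length ys \<Longrightarrow> ys ! i \<otimes> ys ! Suc i \<noteq> \<one>"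
    and three: "\<And>i. Suc (Suc i) < length ys \<Longrightarrow> ys ! i \<otimes> ys ! Suc i \<otimes> ys ! Suc (Suc i) \<noteq> \<one>"
  shows "weak_sequencing G 3 S ys"
proof -
  have mem: "ys ! i \<in> carrier G" if "i < length ys" for i
    using S that nth_mem by blast
  have closed: "partial_sum G ys i \<in> carrier G" if "i \<le> length ys" for i
    using partial_sum_closed S that by simp
  have neq: "partial_sum G ys i \<noteq> partial_sum G ys j"
    if "i < j" "j \<le> i + 3" "j \<le> length ys" for i j
  proof -
    consider "j = Suc i" | "j = Suc (Suc i)" | "j = Suc (Suc (Suc i))"
      using \<open>i < j\<close> \<open>j \<le> i + 3\<close> by linarith
    then show ?thesis
    proof cases
      case 1
      then show ?thesis
        using that one[of i] mem closed[of i] by (auto simp: partial_sum_Suc)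
    next
      case 2
      then have "partial_sum G ys j = partial_sum G ys i \<otimes> (ys ! i \<otimes> ys ! Suc i)"
        using that mem closed[of i] by (simp add: partial_sum_Suc m_assoc)
      then show ?thesis
        using 2 that two[of i] mem closed[of i] by auto
    next
      case 3
      then have "partial_sum G ys j
          = partial_sum G ys i \<otimes> (ys ! i \<otimes> ys ! Suc i \<otimes> ys ! Suc (Suc i))"
        using that mem closed[of i] by (simp add: partial_sum_Suc m_assoc)
      then show ?thesis
        using 3 that three[of i] mem closed[of i] by auto
    qed
  qed
  have "partial_sum G ys i \<noteq> partial_sum G ys j"
    if "i \<le> length ys" "j \<le> length ys" "1 \<le> \<bar>int i - int j\<bar>" "\<bar>int i - int j\<bar> \<le> int 3" for i j
  proof (cases "i < j")
    case True
    then show ?thesis using neq[of i j] that by simp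
  next
    case False
    then have "j < i" "i \<le> j + 3"
      using that by linarith+
    then show ?thesis using neq[of j i] that by simp
  qed
  then show ?thesis
    using assms(1) S(1) unfolding weak_sequencing_def by blast
qed

text \<open>Induction from the front: an even element is chosen for the first gap, and the rest of
  \<open>os\<close> is treated with the remaining even elements, hence the arbitrary
  \<open>E\<close>. The clause on \<open>hd ys\<close> lets the induction hypothesis say which odd
  element closes that gap.\<close>

lemma ex_alternating_parity_odd_triples:
  fixes G :: "('a \<times> int) monoid"
  assumes "group G"
  assumes "finite E" "card E = length os" "os \<noteq> []" "distinct os"
    and "E \<subseteq> carrier G" "set os \<subseteq> carrier G"
    and "\<forall>g\<in>E. even_element g" "\<forall>g\<in>set os. odd_element g"
  shows "\<exists>ys. distinct ys \<and> set ys = set os \<union> E \<and> ys \<noteq> [] \<and> hd ys = hd os \<and>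
    alternating_parity ys \<and>
    (\<forall>i. Suc (Suc i) < length ys \<and> odd_element (ys ! i) \<longrightarrow>
      ys ! i \<otimes>\<^bsub>G\<^esub> ys ! Suc i \<otimes>\<^bsub>G\<^esub> ys ! Suc (Suc i) \<noteq> \<one>\<^bsub>G\<^esub>)"
  using assms(2-)
proof (induction os arbitrary: E)
  case Nil
  then show ?case by simp
next
  case (Cons a os)
  interpret group G by fact
  have disj: "\<not> odd_element g" if "even_element g" for g :: "'a \<times> int"
    using that by (auto simp: even_element_def odd_element_def)
  show ?case
  proof (cases os)
    \<comment> \<open>One odd and one even element remain, and a list of length two has no
      triples.\<close>
    case Nil
    then obtain e where "E = {e}"
      using Cons.prems by (auto simp: card_1_singleton_iff)
    then show ?thesis
      using Cons.prems Nil disj[of e]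
      by (intro exI[of _ "[a, e]"]) (auto simp: alternating_parity_def)
  next
    case (Cons b os')
    \<comment> \<open>Both \<open>a\<close> and \<open>b\<close> are still to be placed, so at least
      two even candidates are left.\<close>
    have "\<not> card E \<le> 1"
      using Cons.prems(2) Cons by simp
    then obtain e0 e1 where e01: "e0 \<in> E" "e1 \<in> E" "e0 \<noteq> e1"
      using Cons.prems(1) by (metis One_nat_def card_le_Suc0_iff_eq)
    have abc: "a \<in> carrier G" "b \<in> carrier G" "e0 \<in> carrier G" "e1 \<in> carrier G"
      using e01 Cons.prems Cons by auto
    \<comment> \<open>By cancellation on both sides, at most one even element placed between
      \<open>a\<close> and \<open>b\<close> gives the identity; one of \<open>e0\<close>,
      \<open>e1\<close> is therefore safe.\<close>
    have "a \<otimes>\<^bsub>G\<^esub> e0 \<otimes>\<^bsub>G\<^esub> b \<noteq> a \<otimes>\<^bsub>G\<^esub> e1 \<otimes>\<^bsub>G\<^esub> b"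
      using abc e01 by simp
    then obtain e where e: "e \<in> E" "a \<otimes>\<^bsub>G\<^esub> e \<otimes>\<^bsub>G\<^esub> b \<noteq> \<one>\<^bsub>G\<^esub>"
      using e01 by metis
    obtain ys where ys: "distinct ys" "set ys = set os \<union> (E - {e})" "ys \<noteq> []" "hd ys = b"
      "alternating_parity ys"
      "\<And>i. Suc (Suc i) < length ys \<Longrightarrow> odd_element (ys ! i) \<Longrightarrow>
        ys ! i \<otimes>\<^bsub>G\<^esub> ys ! Suc i \<otimes>\<^bsub>G\<^esub> ys ! Suc (Suc i) \<noteq> \<one>\<^bsub>G\<^esub>"
    proof -
      have "card (E - {e}) = length os"
        using Cons.prems e by simp
      moreover have "os \<noteq> []" "hd os = b"
        using Cons by simp_all
      moreover have "E - {e} \<subseteq> carrier G"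
        using Cons.prems by blast
      ultimately show thesis
        using Cons.IH[of "E - {e}"] Cons.prems that by simp blast
    qed
    have par: "odd_element a" "even_element e" "odd_element b"
      using Cons.prems e Cons by auto
    have triples: "(a # e # ys) ! i \<otimes>\<^bsub>G\<^esub> (a # e # ys) ! Suc i \<otimes>\<^bsub>G\<^esub> (a # e # ys) ! Suc (Suc i)
        \<noteq> \<one>\<^bsub>G\<^esub>"
      if "Suc (Suc i) < length (a # e # ys)" "odd_element ((a # e # ys) ! i)" for i
    proof -
      \<comment> \<open>At 0 the window is \<open>a\<close>, \<open>e\<close>, \<open>b\<close>,
        safe by the choice of \<open>e\<close>; at 1 it would start with the even \<open>e\<close>,
        which the parity premise excludes; later windows lie inside \<open>ys\<close>.\<close>
      consider "i = 0" | "i = 1" | j where "i = Suc (Suc j)"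
        by (metis One_nat_def not0_implies_Suc)
      then show ?thesis
      proof cases
        case 1
        then show ?thesis using e ys by (simp add: hd_conv_nth)
      next
        case 2
        then show ?thesis using that par disj[of e] by simp
      next
        case 3
        then show ?thesis using that ys(6) by simp
      qed
    qed
    have "a \<notin> E" "e \<notin> set os" "e \<noteq> a"
      using Cons.prems(7,8) par by (auto dest: disj)
    then have "distinct (a # e # ys)" "set (a # e # ys) = set (a # os) \<union> E"
      using ys(1,2) Cons.prems(4) e(1) by auto
    \<comment> \<open>At the junction the even \<open>e\<close> is followed by the odd
      \<open>b\<close>, the head of \<open>ys\<close>.\<close>
    moreover have "alternating_parity (a # e # ys)"
      using ys par by (cases ys) (simp_all add: alternating_parity_def)
    ultimately show ?thesis
      using triples by (intro exI[of _ "a # e # ys"]) auto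
  qed
qed

theorem theorem4p1:
  fixes N :: "('a, 'm) monoid_scheme"
    and \<phi> :: "int \<Rightarrow> 'a \<Rightarrow> 'a"
    and G :: "('a \<times> int) monoid"
    and n k :: nat
    and S :: "('a \<times> int) set"
  assumes "group N"
    and "\<phi> \<in> hom (integer_mod_group 2) (AutoGroup N)"
    and "G = semidirect_product N (integer_mod_group 2) \<phi>"
    and "finite (carrier G)"
    and "order G = n"
    and "even k"
    and "k \<ge> 4"
    and "S \<subseteq> carrier G - {\<one>\<^bsub>G\<^esub>}"
    and "has_type S (k div 2) (k div 2)"
  shows "\<exists>ys. weak_sequencing G 3 S ys \<and> alternating_parity ys"
proof -
  have "group G"
    using group_semidirect_product[OF assms(1) group_integer_mod_group assms(2)] assms(3) by simp
  then interpret group G .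
  have S: "S \<subseteq> carrier G" "\<one>\<^bsub>G\<^esub> \<notin> S"
    using assms(8) by auto
  \<comment> \<open>The second projection is a homomorphism onto the group of order two, so parities
    add modulo 2 and a product of odd parity cannot be the identity.\<close>
  have snd_mult: "snd (g \<otimes>\<^bsub>G\<^esub> h) = (snd g + snd h) mod 2" for g h
    using assms(3) by (cases g; cases h) (simp add: mult_integer_mod_group)
  have snd_one: "snd \<one>\<^bsub>G\<^esub> = 0"
    using assms(3) by simp
  define E where "E = {g \<in> S. even_element g}"
  define D where "D = {g \<in> S. odd_element g}"
  \<comment> \<open>Second components have type \<open>int\<close>; membership in the carrier is
    what forces every element of \<open>S\<close> to be even or odd.\<close>
  have "snd g = 0 \<or> snd g = 1" if "g \<in> S" for g
  proof -
    have "snd g \<in> carrier (integer_mod_group 2)"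
      using S that assms(3) by auto
    then show ?thesis by (auto simp: carrier_integer_mod_group)
  qed
  then have ED: "D \<union> E = S"
    by (auto simp: E_def D_def even_element_def odd_element_def)
  have fin: "finite E" "finite D" and card: "card E = k div 2" "card D = k div 2"
    using assms(9) by (auto simp: has_type_def E_def D_def)
  obtain os where os: "set os = D" "distinct os"
    using finite_distinct_list[OF fin(2)] by blast
  then have len: "length os = k div 2"
    using card distinct_card by fastforce
  then have "os \<noteq> []"
    using assms(7) by auto
  have "E \<subseteq> carrier G" "set os \<subseteq> carrier G"
    and "\<forall>g\<in>E. even_element g" "\<forall>g\<in>set os. odd_element g"
    using S os by (auto simp: E_def D_def)
  from ex_alternating_parity_odd_triples[OF \<open>group G\<close> fin(1) _ \<open>os \<noteq> []\<close> os(2) this]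
  obtain ys where ys: "distinct ys" "set ys = S" "alternating_parity ys"
    "\<And>i. Suc (Suc i) < length ys \<Longrightarrow> odd_element (ys ! i) \<Longrightarrow>
      ys ! i \<otimes>\<^bsub>G\<^esub> ys ! Suc i \<otimes>\<^bsub>G\<^esub> ys ! Suc (Suc i) \<noteq> \<one>\<^bsub>G\<^esub>"
    using card(1) len os(1) ED by auto
  have alt: "even_element (ys ! i) \<and> odd_element (ys ! Suc i) \<or>
      odd_element (ys ! i) \<and> even_element (ys ! Suc i)" if "Suc i < length ys" for i
    using ys(3) that by (auto simp: alternating_parity_def successively_conv_nth)
  have "weak_sequencing G 3 S ys"
  proof (rule weak_sequencing_3I[OF ys(1,2) S(1)])
    fix i assume "i < length ys"
    then show "ys ! i \<noteq> \<one>\<^bsub>G\<^esub>"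
      using ys(2) S(2) nth_mem by metis
  next
    fix i assume "Suc i < length ys"
    then have "snd (ys ! i \<otimes>\<^bsub>G\<^esub> ys ! Suc i) = 1"
      using alt by (fastforce simp: snd_mult even_element_def odd_element_def)
    then show "ys ! i \<otimes>\<^bsub>G\<^esub> ys ! Suc i \<noteq> \<one>\<^bsub>G\<^esub>"
      using snd_one by auto
  next
    fix i assume i: "Suc (Suc i) < length ys"
    show "ys ! i \<otimes>\<^bsub>G\<^esub> ys ! Suc i \<otimes>\<^bsub>G\<^esub> ys ! Suc (Suc i) \<noteq> \<one>\<^bsub>G\<^esub>"
    proof (cases "odd_element (ys ! i)")
      case True
      then show ?thesis using ys(4) i by blast
    next
      \<comment> \<open>By alternation the window is even-odd-even, with parity 0 + 1 + 0 =
        1.\<close>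
      case False
      then have "snd (ys ! i \<otimes>\<^bsub>G\<^esub> ys ! Suc i \<otimes>\<^bsub>G\<^esub> ys ! Suc (Suc i)) = 1"
        using alt[of i] alt[of "Suc i"] i
        by (auto simp: snd_mult even_element_def odd_element_def)
      then show ?thesis using snd_one by auto
    qed
  qed
  then show ?thesis using ys(3) by blast
qed

end
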